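(* Let $\mathbf{C}\in\mathbb{R}^{n\times n}$, $\mathbf{C}'\in\mathbb{R}^{n'\times n'}$ be any symmetric matrices and $\mathbf{w}\in\Sigma_n$, $\mathbf{w}'\in\Sigma_{n'}$. Then $$COOT(\mathbf{C},\mathbf{C}',\mathbf{w},\mathbf{w}',\mathbf{w},\mathbf{w}')\le GW(\mathbf{C},\mathbf{C}',\mathbf{w},\mathbf{w}').$$ The converse inequality also holds when $L(a,b)=|a-b|^2$ and either (a) $\mathbf{C},\mathbf{C}'$ are squared Euclidean distance matrices, i.e. $\mathbf{C}=\mathbf{x}\mathbf{1}_n^T+\mathbf{1}_n\mathbf{x}^T-2\mathbf{X}\mathbf{X}^T$ and $\mathbf{C}'=\mathbf{x}'\mathbf{1}_{n'}^T+\mathbf{1}_{n'}\mathbf{x}'^T-2\mathbf{X}'\mathbf{X}'^T$ with $\mathbf{x}=\mathrm{diag}(\mathbf{X}\mathbf{X}^T)$, $\mathbf{x}'=\mathrm{diag}(\mathbf{X}'\mathbf{X}'^T)$ for some real matrices $\mathbf{X}$ (with $n$ rows) and $\mathbf{X}'$ (with $n'$ rows); or (b) $\mathbf{C},\mathbf{C}'$ are inner product similarities, i.e. $\mathbf{C}=\mathbf{X}\mathbf{X}^T$, $\mathbf{C}'=\mathbf{X}'\mathbf{X}'^T$ for such matrices. In these cases, if $(\pi^s_*,\pi^v_* )$ is an optimal solution of the $COOT$ problem, then both $\pi^s_*$ and $\pi^v_*$ are solutions of the $GW$ problem; conversely, if $\pi^s_*$ is an optimal solution of the $GW$ problem, then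 $(\pi^s_*,\pi^s_* )$ is an optimal solution of the $COOT$ problem.
   Context: $\Sigma_n$ is the set of probability vectors in $\mathbb{R}^n$; $\Pi(\mathbf{w},\mathbf{w}')$ is the set of nonnegative $n\times n'$ matrices with row sums $\mathbf{w}$ and column sums $\mathbf{w}'$; $L:\mathbb{R}\times\mathbb{R}\to\mathbb{R}_+$ is a loss. Then $$COOT(\mathbf{C},\mathbf{C}',\mathbf{w},\mathbf{w}',\mathbf{w},\mathbf{w}')=\min_{\pi^s,\pi^v\in\Pi(\mathbf{w},\mathbf{w}')}\sum_{i,j,k,l}L(C_{i,k},C'_{j,l})\,\pi^s_{i,j}\pi^v_{k,l},$$ $$GW(\mathbf{C},\mathbf{C}',\mathbf{w},\mathbf{w}')=\min_{\pi^s\in\Pi(\mathbf{w},\mathbf{w}')}\sum_{i,j,k,l}L(C_{i,k},C'_{j,l})\,\pi^s_{i,j}\pi^s_{k,l}.$$ For a square matrix $M$, $\mathrm{diag}(M)$ is the column vector of its diagonal entries. *)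

theory Defs
  imports "HOL-Analysis.Analysis"
begin

text \<open>An \<open>m \<times> n\<close> matrix is an element of \<open>real^'n^'m\<close>: rows are the outer index.\<close>

definition prob_vectors :: "(real^'n) set" where
  "prob_vectors = {w. (\<forall>i. 0 \<le> w $ i) \<and> (\<Sum>i\<in>UNIV. w $ i) = 1}"

definition couplings :: "real^'n \<Rightarrow> real^'m \<Rightarrow> (real^'m^'n) set" where
  "couplings w w' = {P. (\<forall>i j. 0 \<le> P $ i $ j) \<and>
     (\<forall>i. (\<Sum>j\<in>UNIV. P $ i $ j) = w $ i) \<and>
     (\<forall>j. (\<Sum>i\<in>UNIV. P $ i $ j) = w' $ j)}"

definition transport_cost ::
  "(real \<Rightarrow> real \<Rightarrow> real) \<Rightarrow> real^'d^'n \<Rightarrow> real^'e^'m \<Rightarrow> real^'m^'n \<Rightarrow> real^'e^'d \<Rightarrow> real" where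
  "transport_cost L C C' S V =
     (\<Sum>i\<in>UNIV. \<Sum>j\<in>UNIV. \<Sum>k\<in>UNIV. \<Sum>l\<in>UNIV.
        L (C $ i $ k) (C' $ j $ l) * S $ i $ j * V $ k $ l)"

text \<open>
  Co-optimal transport for data matrices of arbitrary shape, with sample weights \<open>w\<close>, \<open>w'\<close> and
  feature weights \<open>v\<close>, \<open>v'\<close>. The minimum is expressed as the least element of the set of attained
  costs; it exists whenever the weights are probability vectors
  (lemmas \<open>coot_solution_exists\<close>, \<open>coot_eq\<close>, \<open>gw_solution_exists\<close>, \<open>gw_eq\<close> below).
\<close>

definition coot ::
  "(real \<Rightarrow> real \<Rightarrow> real) \<Rightarrow> real^'d^'n \<Rightarrow> real^'e^'m \<Rightarrow>
   real^'n \<Rightarrow> real^'m \<Rightarrow> real^'d \<Rightarrow> real^'e \<Rightarrow> real" where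
  "coot L C C' w w' v v' =
     (LEAST c. c \<in> (\<lambda>(S, V). transport_cost L C C' S V) ` (couplings w w' \<times> couplings v v'))"

definition coot_solution ::
  "(real \<Rightarrow> real \<Rightarrow> real) \<Rightarrow> real^'d^'n \<Rightarrow> real^'e^'m \<Rightarrow>
   real^'n \<Rightarrow> real^'m \<Rightarrow> real^'d \<Rightarrow> real^'e \<Rightarrow> (real^'m^'n) \<times> (real^'e^'d) \<Rightarrow> bool" where
  "coot_solution L C C' w w' v v' =
     is_arg_min (\<lambda>(S, V). transport_cost L C C' S V) (\<lambda>p. p \<in> couplings w w' \<times> couplings v v')"

definition gw ::
  "(real \<Rightarrow> real \<Rightarrow> real) \<Rightarrow> real^'n^'n \<Rightarrow> real^'m^'m \<Rightarrow> real^'n \<Rightarrow> real^'m \<Rightarrow> real" where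
  "gw L C C' w w' =
     (LEAST c. c \<in> (\<lambda>S. transport_cost L C C' S S) ` couplings w w')"

definition gw_solution ::
  "(real \<Rightarrow> real \<Rightarrow> real) \<Rightarrow> real^'n^'n \<Rightarrow> real^'m^'m \<Rightarrow>
   real^'n \<Rightarrow> real^'m \<Rightarrow> real^'m^'n \<Rightarrow> bool" where
  "gw_solution L C C' w w' =
     is_arg_min (\<lambda>S. transport_cost L C C' S S) (\<lambda>S. S \<in> couplings w w')"

text \<open>Column vectors are \<open>n \<times> 1\<close> matrices, so that the outer products below are matrix products.\<close>

definition diag_col :: "real^'n^'n \<Rightarrow> real^1^'n" where
  "diag_col M = columnvector (\<chi> i. M $ i $ i)"

definition ones_col :: "real^1^'n" where
  "ones_col = columnvector (\<chi> i. 1)"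

definition inner_product_matrix :: "real^'p^'n \<Rightarrow> real^'n^'n" where
  "inner_product_matrix X = X ** transpose X"

definition squared_distance_matrix :: "real^'p^'n \<Rightarrow> real^'n^'n" where
  "squared_distance_matrix X =
     (let x = diag_col (X ** transpose X)
      in x ** transpose ones_col + ones_col ** transpose x - 2 *\<^sub>R (X ** transpose X))"

lemma squared_distance_matrix_nth:
  "squared_distance_matrix X $ i $ j = (norm (row i X - row j X))\<^sup>2"
proof -
  let ?G = "\<lambda>i j. \<Sum>k\<in>UNIV. X $ i $ k * X $ j $ k"
  have "(norm (row i X - row j X))\<^sup>2 = (\<Sum>k\<in>UNIV. (X $ i $ k - X $ j $ k) * (X $ i $ k - X $ j $ k))"
    by (simp add: row_def power2_norm_eq_inner inner_vec_def)
  also have "\<dots> = (\<Sum>k\<in>UNIV. X $ i $ k * X $ i $ k + X $ j $ k * X $ j $ k - 2 * (X $ i $ k * X $ j $ k))"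
    by (rule sum.cong) (auto simp: algebra_simps)
  also have "\<dots> = ?G i i + ?G j j - 2 * ?G i j"
    by (simp only: sum.distrib sum_subtractf sum_distrib_left)
  finally show ?thesis
    by (simp add: squared_distance_matrix_def Let_def diag_col_def ones_col_def columnvector_def
        matrix_matrix_mult_def transpose_def)
qed

lemma couplings_nonempty:
  assumes "w \<in> prob_vectors" "w' \<in> prob_vectors"
  shows "couplings w w' \<noteq> {}"
proof -
  have "(\<chi> i j. w $ i * w' $ j) \<in> couplings w w'"
    using assms
    by (simp add: couplings_def prob_vectors_def flip: sum_distrib_left sum_distrib_right)
  then show ?thesis by blast
qed

lemma compact_couplings:
  fixes w :: "real^'n" and w' :: "real^'m"
  shows "compact (couplings w w')"
proof -
  have "closed (couplings w w')"
  proof -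
    have "closed {P :: real^'m^'n. 0 \<le> P $ i $ j}" for i j
      by (intro closed_Collect_le continuous_intros)
    moreover have "closed {P :: real^'m^'n. (\<Sum>j\<in>UNIV. P $ i $ j) = w $ i}" for i
      by (intro closed_Collect_eq continuous_intros)
    moreover have "closed {P :: real^'m^'n. (\<Sum>i\<in>UNIV. P $ i $ j) = w' $ j}" for j
      by (intro closed_Collect_eq continuous_intros)
    ultimately show ?thesis
      unfolding couplings_def by (intro closed_Collect_conj closed_Collect_all)
  qed
  moreover have "bounded (couplings w w')"
  proof -
    have "norm P \<le> (\<Sum>i\<in>UNIV. \<bar>w $ i\<bar>)" if "P \<in> couplings w w'" for P
    proof -
      have "norm (P $ i) \<le> \<bar>w $ i\<bar>" for i
      proof -
        have "norm (P $ i) \<le> (\<Sum>j\<in>UNIV. \<bar>P $ i $ j\<bar>)" by (rule norm_le_l1_cart)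
        also have "\<dots> = w $ i" using that by (simp add: couplings_def)
        finally show ?thesis by simp
      qed
      then have "(\<Sum>i\<in>UNIV. norm (P $ i)) \<le> (\<Sum>i\<in>UNIV. \<bar>w $ i\<bar>)"
        by (rule sum_mono)
      moreover have "norm P \<le> (\<Sum>i\<in>UNIV. norm (P $ i))"
        unfolding norm_vec_def by (rule L2_set_le_sum) simp
      ultimately show ?thesis by linarith
    qed
    then show ?thesis by (auto simp: bounded_iff)
  qed
  ultimately show ?thesis by (simp add: compact_eq_bounded_closed)
qed

lemma coot_solution_exists:
  assumes "w \<in> prob_vectors" "w' \<in> prob_vectors" "v \<in> prob_vectors" "v' \<in> prob_vectors"
  shows "\<exists>p. coot_solution L C C' w w' v v' p"
proof -
  let ?K = "couplings w w' \<times> couplings v v'"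
  have "compact ?K" by (intro compact_Times compact_couplings)
  moreover have "?K \<noteq> {}"
    using couplings_nonempty [OF assms(1,2)] couplings_nonempty [OF assms(3,4)] by simp
  moreover have "continuous_on ?K (\<lambda>(S, V). transport_cost L C C' S V)"
    unfolding transport_cost_def case_prod_beta by (intro continuous_intros)
  ultimately show ?thesis
    using continuous_attains_inf [of ?K]
    unfolding coot_solution_def is_arg_min_linorder by blast
qed

lemma gw_solution_exists:
  assumes "w \<in> prob_vectors" "w' \<in> prob_vectors"
  shows "\<exists>S. gw_solution L C C' w w' S"
proof -
  have "continuous_on (couplings w w') (\<lambda>S. transport_cost L C C' S S)"
    unfolding transport_cost_def by (intro continuous_intros)
  then show ?thesis
    using continuous_attains_inf [OF compact_couplings couplings_nonempty [OF assms]]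
    unfolding gw_solution_def is_arg_min_linorder by blast
qed

lemma coot_eq:
  assumes "coot_solution L C C' w w' v v' (S, V)"
  shows "coot L C C' w w' v v' = transport_cost L C C' S V"
  unfolding coot_def
  by (rule Least_equality)
    (use assms in \<open>force simp: coot_solution_def is_arg_min_linorder\<close>)+

lemma gw_eq:
  assumes "gw_solution L C C' w w' S"
  shows "gw L C C' w w' = transport_cost L C C' S S"
  unfolding gw_def
  by (rule Least_equality)
    (use assms in \<open>auto simp: gw_solution_def is_arg_min_linorder\<close>)

end

theory Submission
  imports Defs
begin

text \<open>
  For symmetric \<open>C\<close>, \<open>C'\<close> the cost \<open>T(S, V)\<close> is a symmetric bilinear form, and COOT relaxes GW, which
  is its restriction to the diagonal. A difference \<open>D\<close> of two couplings has zero marginals, so in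
  \<open>T(D, D)\<close> only the part of the loss depending on all four indices survives. For the squared loss
  and both kinds of matrices this part is \<open>-2c\<^sup>2 \<langle>X\<^sub>i, X\<^sub>k\<rangle> \<langle>X'\<^sub>j, X'\<^sub>l\<rangle>\<close>, which contributes
  \<open>-2c\<^sup>2 \<parallel>X\<^sup>T D X'\<parallel>\<^sup>2 \<le> 0\<close>. Hence \<open>T(S, S) + T(V, V) \<le> 2 T(S, V)\<close>, and at a minimiser
  \<open>(S, V)\<close> of \<open>T\<close> all three values coincide.
\<close>

lemma sum_UNIV_pairs:
  fixes F :: "'a::finite \<Rightarrow> 'b::finite \<Rightarrow> 'c::finite \<Rightarrow> 'd::finite \<Rightarrow> 'e::comm_monoid_add"
  shows "(\<Sum>i\<in>UNIV. \<Sum>j\<in>UNIV. \<Sum>k\<in>UNIV. \<Sum>l\<in>UNIV. F i j k l) =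
    (\<Sum>(i, j)\<in>UNIV. \<Sum>(k, l)\<in>UNIV. F i j k l)"
proof -
  have "(\<Sum>i\<in>UNIV. \<Sum>j\<in>UNIV. \<Sum>k\<in>UNIV. \<Sum>l\<in>UNIV. F i j k l) =
      (\<Sum>i\<in>UNIV. \<Sum>j\<in>UNIV. \<Sum>(k, l)\<in>UNIV. F i j k l)"
    by (intro sum.cong refl) (simp only: sum.cartesian_product UNIV_Times_UNIV)
  also have "\<dots> = (\<Sum>(i, j)\<in>UNIV. \<Sum>(k, l)\<in>UNIV. F i j k l)"
    by (subst sum.cartesian_product) simp
  finally show ?thesis .
qed

text \<open>Once the quadruple sum is a double sum over index pairs, a single
  \<open>sum.swap\<close> exchanges (i, j) with (k, l).\<close>

lemma sum_swap_pairs: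
  fixes F :: "'a::finite \<Rightarrow> 'b::finite \<Rightarrow> 'c::finite \<Rightarrow> 'd::finite \<Rightarrow> 'e::comm_monoid_add"
  shows "(\<Sum>i\<in>UNIV. \<Sum>j\<in>UNIV. \<Sum>k\<in>UNIV. \<Sum>l\<in>UNIV. F i j k l) =
    (\<Sum>k\<in>UNIV. \<Sum>l\<in>UNIV. \<Sum>i\<in>UNIV. \<Sum>j\<in>UNIV. F i j k l)"
  unfolding sum_UNIV_pairs case_prod_beta by (rule sum.swap)

text \<open>Exchanging (i, j) with (k, l) swaps the two couplings and transposes both matrices,
  which symmetry undoes.\<close>

lemma transport_cost_commute:
  fixes C :: "real^'n^'n" and C' :: "real^'m^'m"
  assumes "transpose C = C" "transpose C' = C'"
  shows "transport_cost L C C' S V = transport_cost L C C' V S"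
proof -
  have C: "C $ i $ k = C $ k $ i" for i k
    using arg_cong [OF assms(1), of "\<lambda>M. M $ k $ i"] by (simp add: transpose_def)
  have C': "C' $ j $ l = C' $ l $ j" for j l
    using arg_cong [OF assms(2), of "\<lambda>M. M $ l $ j"] by (simp add: transpose_def)
  show ?thesis
    unfolding transport_cost_def
    by (subst sum_swap_pairs, intro sum.cong refl)
      (subst C, subst C', simp add: mult_ac)
qed

lemma transport_cost_diff_diff:
  fixes C :: "real^'n^'n" and C' :: "real^'m^'m"
  assumes "transpose C = C" "transpose C' = C'"
  shows "transport_cost L C C' (S - V) (S - V) =
    transport_cost L C C' S S + transport_cost L C C' V V - 2 * transport_cost L C C' S V"
proof -
  have "transport_cost L C C' (S - V) (S - V) =
      transport_cost L C C' S S + transport_cost L C C' V V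
      - transport_cost L C C' S V - transport_cost L C C' V S"
    unfolding transport_cost_def
    by (simp add: algebra_simps flip: sum.distrib sum_subtractf)
  then show ?thesis
    by (simp add: transport_cost_commute [OF assms, of L V S])
qed

lemma sum_product_inner_product_matrix_nonneg:
  fixes X :: "real^'p^'n" and X' :: "real^'q^'m" and D :: "real^'m^'n"
  shows "0 \<le> (\<Sum>i\<in>UNIV. \<Sum>j\<in>UNIV. \<Sum>k\<in>UNIV. \<Sum>l\<in>UNIV.
    inner_product_matrix X $ i $ k * inner_product_matrix X' $ j $ l * D $ i $ j * D $ k $ l)"
    (is "0 \<le> ?lhs")
proof -
  \<comment> \<open>Summed over (i, j), \<open>?f (a, b) (i, j)\<close> gives entry (a, b) of
    \<open>transpose X ** D ** X'\<close>; the goal is the sum of the squares of these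
    entries.\<close>
  let ?f = "\<lambda>(a, b) (i, j). X $ i $ a * X' $ j $ b * D $ i $ j"
  have entry: "inner_product_matrix X $ i $ k * inner_product_matrix X' $ j $ l * D $ i $ j * D $ k $ l
      = (\<Sum>c\<in>UNIV. ?f c (i, j) * ?f c (k, l))" for i j k l
  proof -
    have "inner_product_matrix X $ i $ k * inner_product_matrix X' $ j $ l =
        (\<Sum>a\<in>UNIV. \<Sum>b\<in>UNIV. (X $ i $ a * X $ k $ a) * (X' $ j $ b * X' $ l $ b))"
      by (simp add: inner_product_matrix_def matrix_matrix_mult_def transpose_def sum_product)
    also have "\<dots> = (\<Sum>(a, b)\<in>UNIV. (X $ i $ a * X $ k $ a) * (X' $ j $ b * X' $ l $ b))"
      by (simp add: sum.cartesian_product flip: UNIV_Times_UNIV)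
    finally show ?thesis
      by (simp add: sum_distrib_left sum_distrib_right case_prod_beta mult_ac)
  qed
  have "?lhs = (\<Sum>r\<in>UNIV. \<Sum>s\<in>UNIV. \<Sum>c\<in>UNIV. ?f c r * ?f c s)"
    by (subst sum_UNIV_pairs) (simp add: entry case_prod_beta)
  also have "\<dots> = (\<Sum>r\<in>UNIV. \<Sum>c\<in>UNIV. \<Sum>s\<in>UNIV. ?f c r * ?f c s)"
    by (intro sum.cong refl sum.swap)
  also have "\<dots> = (\<Sum>c\<in>UNIV. \<Sum>r\<in>UNIV. \<Sum>s\<in>UNIV. ?f c r * ?f c s)"
    by (rule sum.swap)
  also have "\<dots> = (\<Sum>c\<in>UNIV. (\<Sum>r\<in>UNIV. ?f c r)\<^sup>2)"
    by (simp add: power2_eq_square sum_product)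
  finally show ?thesis
    by (simp add: sum_nonneg)
qed

text \<open>The shape of \<open>C\<close> and \<open>C'\<close> covers squared distances and inner
  products at once. Sharing \<open>c\<close> between them makes the coefficient of the surviving
  term -2c^2, whatever the sign of \<open>c\<close>.\<close>

lemma transport_cost_square_nonpos:
  fixes X :: "real^'p^'n" and X' :: "real^'q^'m" and D :: "real^'m^'n"
  assumes rows: "\<And>i. (\<Sum>j\<in>UNIV. D $ i $ j) = 0" and cols: "\<And>j. (\<Sum>i\<in>UNIV. D $ i $ j) = 0"
    and C: "\<And>i k. C $ i $ k = f i + f k + c * inner_product_matrix X $ i $ k"
    and C': "\<And>j l. C' $ j $ l = g j + g l + c * inner_product_matrix X' $ j $ l"
  shows "transport_cost (\<lambda>a b. \<bar>a - b\<bar>\<^sup>2) C C' D D \<le> 0"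
proof -
  let ?G = "\<lambda>i k. inner_product_matrix X $ i $ k" and ?H = "\<lambda>j l. inner_product_matrix X' $ j $ l"
  let ?sum = "\<lambda>F. \<Sum>i\<in>UNIV. \<Sum>j\<in>UNIV. \<Sum>k\<in>UNIV. \<Sum>l\<in>UNIV. (F i j k l :: real) * D $ i $ j * D $ k $ l"
  \<comment> \<open>the summands of the loss, grouped by the index on which they do not depend\<close>
  let ?l = "\<lambda>i j k. (C $ i $ k)\<^sup>2 - 2 * c * ?G i k * g j"
    and ?k = "\<lambda>i j l. (C' $ j $ l)\<^sup>2 - 2 * f i * C' $ j $ l"
    and ?i = "\<lambda>j k l. - 2 * f k * C' $ j $ l" and ?j = "\<lambda>i k l. - 2 * c * ?G i k * g l"
  have no_l: "?sum (\<lambda>i j k l. F i j k) = 0" for F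
    by (simp add: rows flip: sum_distrib_left)
  \<comment> \<open>Summation over k has to become innermost before the zero column sums of
    \<open>D\<close> apply.\<close>
  have no_k: "?sum (\<lambda>i j k l. F i j l) = 0" for F
  proof -
    have "?sum (\<lambda>i j k l. F i j l) =
        (\<Sum>i\<in>UNIV. \<Sum>j\<in>UNIV. \<Sum>l\<in>UNIV. \<Sum>k\<in>UNIV. F i j l * D $ i $ j * D $ k $ l)"
      by (intro sum.cong refl sum.swap)
    then show ?thesis by (simp add: cols flip: sum_distrib_left)
  qed
  \<comment> \<open>The weight \<open>D $ i $ j * D $ k $ l\<close> is invariant under exchanging
    the pairs, so the cases of i and j reduce to those of k and l.\<close>
  have swap: "?sum F = ?sum (\<lambda>k l i j. F i j k l)" for F
    by (subst sum_swap_pairs) (simp add: mult_ac)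
  have no_i: "?sum (\<lambda>i j k l. F j k l) = 0" for F
    by (subst swap) (rule no_k)
  have no_j: "?sum (\<lambda>i j k l. F i k l) = 0" for F
    by (subst swap) (rule no_l)
  have "\<bar>C $ i $ k - C' $ j $ l\<bar>\<^sup>2 =
      ?l i j k + ?k i j l + ?i j k l + ?j i k l + - 2 * c\<^sup>2 * (?G i k * ?H j l)" for i j k l
  proof -
    \<comment> \<open>The squares stay unexpanded, as each misses two indices. Expanding
      \<open>C\<close> in the cross term leaves only the product of \<open>?G i k\<close> with
      \<open>C'\<close> depending on all four indices, so \<open>C'\<close> is expanded there
      alone.\<close>
    have "\<bar>C $ i $ k - C' $ j $ l\<bar>\<^sup>2 = (C $ i $ k)\<^sup>2 + (C' $ j $ l)\<^sup>2
        - 2 * f i * C' $ j $ l - 2 * f k * C' $ j $ l - 2 * c * ?G i k * C' $ j $ l"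
      by (simp add: power2_diff C) (simp add: algebra_simps)
    then show ?thesis
      by (subst (asm) (4) C') (simp add: algebra_simps power2_eq_square)
  qed
  then have "transport_cost (\<lambda>a b. \<bar>a - b\<bar>\<^sup>2) C C' D D =
      ?sum (\<lambda>i j k l. ?l i j k + ?k i j l + ?i j k l + ?j i k l + - 2 * c\<^sup>2 * (?G i k * ?H j l))"
    unfolding transport_cost_def by simp
  also have "\<dots> = ?sum (\<lambda>i j k l. ?l i j k) + ?sum (\<lambda>i j k l. ?k i j l) + ?sum (\<lambda>i j k l. ?i j k l)
      + ?sum (\<lambda>i j k l. ?j i k l) + ?sum (\<lambda>i j k l. - 2 * c\<^sup>2 * (?G i k * ?H j l))"
    by (simp only: distrib_right sum.distrib)
  also have "\<dots> = - 2 * c\<^sup>2 * ?sum (\<lambda>i j k l. ?G i k * ?H j l)"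
    unfolding no_l no_k no_i no_j by (simp add: sum_distrib_left mult.assoc)
  also have "\<dots> \<le> 0"
    using sum_product_inner_product_matrix_nonneg [of X X' D] by simp
  finally show ?thesis .
qed

text \<open>Both diagonal values are at least the minimum \<open>B S V\<close>, while
  \<open>diag\<close> bounds their sum by twice that minimum.\<close>

lemma arg_min_diagonal:
  fixes B :: "'a \<Rightarrow> 'a \<Rightarrow> real"
  assumes diag: "\<And>S V. S \<in> K \<Longrightarrow> V \<in> K \<Longrightarrow> B S S + B V V \<le> 2 * B S V"
    and min: "is_arg_min (\<lambda>(S, V). B S V) (\<lambda>p. p \<in> K \<times> K) (S, V)"
  shows "B S S = B S V" "B V V = B S V"
proof -
  have "S \<in> K" "V \<in> K" and *: "\<And>P Q. P \<in> K \<Longrightarrow> Q \<in> K \<Longrightarrow> B S V \<le> B P Q"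
    using min by (auto simp: is_arg_min_linorder)
  with diag [of S V] *[of S S] *[of V V] show "B S S = B S V" "B V V = B S V"
    by linarith+
qed

theorem proposition5p5p2:
  fixes L :: "real \<Rightarrow> real \<Rightarrow> real"
    and C :: "real^'n^'n" and C' :: "real^'m^'m"
    and w :: "real^'n" and w' :: "real^'m"
    and X :: "real^'p^'n" and X' :: "real^'q^'m"
  assumes "\<And>a b. 0 \<le> L a b"
    and "transpose C = C" and "transpose C' = C'"
    and "w \<in> prob_vectors" and "w' \<in> prob_vectors"
  shows "coot L C C' w w' w w' \<le> gw L C C' w w' \<and>
    (L = (\<lambda>a b. \<bar>a - b\<bar>\<^sup>2) \<and>
     ((C = squared_distance_matrix X \<and> C' = squared_distance_matrix X') \<or>
      (C = inner_product_matrix X \<and> C' = inner_product_matrix X')) \<longrightarrow>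
       gw L C C' w w' \<le> coot L C C' w w' w w' \<and>
       (\<forall>S V. coot_solution L C C' w w' w w' (S, V) \<longrightarrow>
          gw_solution L C C' w w' S \<and> gw_solution L C C' w w' V) \<and>
       (\<forall>S. gw_solution L C C' w w' S \<longrightarrow> coot_solution L C C' w w' w w' (S, S)))"
proof -
  let ?T = "transport_cost L C C'" and ?K = "couplings w w'"
  obtain S\<^sub>0 V\<^sub>0 where coot0: "coot_solution L C C' w w' w w' (S\<^sub>0, V\<^sub>0)"
    using coot_solution_exists assms(4,5) by (metis surj_pair)
  obtain R where gw0: "gw_solution L C C' w w' R"
    using gw_solution_exists assms(4,5) by blast
  have coot_iff: "coot_solution L C C' w w' w w' (S, V) \<longleftrightarrow>
      S \<in> ?K \<and> V \<in> ?K \<and> (\<forall>P\<in>?K. \<forall>Q\<in>?K. ?T S V \<le> ?T P Q)" for S V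
    by (auto simp: coot_solution_def is_arg_min_linorder)
  have gw_iff: "gw_solution L C C' w w' S \<longleftrightarrow> S \<in> ?K \<and> (\<forall>P\<in>?K. ?T S S \<le> ?T P P)" for S
    by (auto simp: gw_solution_def is_arg_min_linorder)
  \<comment> \<open>\<open>(R, R)\<close> is a competitor in the COOT problem.\<close>
  have le: "coot L C C' w w' w w' \<le> gw L C C' w w'"
    using coot0 gw0 unfolding coot_eq [OF coot0] gw_eq [OF gw0] by (simp add: coot_iff gw_iff)
  have "gw L C C' w w' \<le> coot L C C' w w' w w' \<and>
      (\<forall>S V. coot_solution L C C' w w' w w' (S, V) \<longrightarrow>
         gw_solution L C C' w w' S \<and> gw_solution L C C' w w' V) \<and>
      (\<forall>S. gw_solution L C C' w w' S \<longrightarrow> coot_solution L C C' w w' w w' (S, S))"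
    if L: "L = (\<lambda>a b. \<bar>a - b\<bar>\<^sup>2)"
      and CC: "(C = squared_distance_matrix X \<and> C' = squared_distance_matrix X') \<or>
        (C = inner_product_matrix X \<and> C' = inner_product_matrix X')"
  proof -
    \<comment> \<open>For squared distances, \<open>c\<close> is -2 and \<open>f\<close>,
      \<open>g\<close> are the squared norms of the rows of \<open>X\<close>, \<open>X'\<close>; for
      inner products, \<open>c\<close> is 1 and \<open>f\<close>, \<open>g\<close> vanish.\<close>
    obtain f g c where f: "\<And>i k. C $ i $ k = f i + f k + c * inner_product_matrix X $ i $ k"
      and g: "\<And>j l. C' $ j $ l = g j + g l + c * inner_product_matrix X' $ j $ l"
      using CC
    proof (elim disjE conjE)
      assume "C = squared_distance_matrix X" "C' = squared_distance_matrix X'"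
      then show thesis
        by (intro that [of "\<lambda>i. inner_product_matrix X $ i $ i" "-2"
              "\<lambda>j. inner_product_matrix X' $ j $ j"])
          (simp_all add: squared_distance_matrix_def inner_product_matrix_def Let_def diag_col_def
            ones_col_def columnvector_def matrix_matrix_mult_def transpose_def)
    next
      assume "C = inner_product_matrix X" "C' = inner_product_matrix X'"
      then show thesis by (intro that [of "\<lambda>_. 0" 1 "\<lambda>_. 0"]) simp_all
    qed
    have diag: "?T S S + ?T V V \<le> 2 * ?T S V" if "S \<in> ?K" "V \<in> ?K" for S V
    proof -
      have "?T (S - V) (S - V) \<le> 0"
        unfolding L using that
        by (intro transport_cost_square_nonpos [OF _ _ f g])
          (simp_all add: couplings_def sum_subtractf)
      then show ?thesis
        by (simp add: transport_cost_diff_diff [OF assms(2,3)])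
    qed
    have eq: "?T S S = ?T S V" "?T V V = ?T S V"
      if "coot_solution L C C' w w' w w' (S, V)" for S V
      using arg_min_diagonal [where B = ?T and K = ?K, OF diag] that
      by (simp_all add: coot_solution_def)
    have sols: "gw_solution L C C' w w' S \<and> gw_solution L C C' w w' V"
      if "coot_solution L C C' w w' w w' (S, V)" for S V
      using that eq [OF that] by (simp add: coot_iff gw_iff)
    have "coot_solution L C C' w w' w w' (S, S)" if "gw_solution L C C' w w' S" for S
    proof -
      \<comment> \<open>\<open>S\<^sub>0\<close> competes in the GW problem, and its cost there is
        the COOT minimum \<open>?T S\<^sub>0 V\<^sub>0\<close>.\<close>
      have "?T S S \<le> ?T S\<^sub>0 V\<^sub>0"
        using that coot0 eq(1) [OF coot0] by (metis coot_iff gw_iff)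
      then show ?thesis
        using that coot0 by (meson coot_iff gw_iff order_trans)
    qed
    moreover have "gw L C C' w w' \<le> coot L C C' w w' w w'"
      using sols [OF coot0] eq [OF coot0] by (metis coot_eq [OF coot0] gw_eq order_refl)
    ultimately show ?thesis using sols by blast
  qed
  with le show ?thesis by blast
qed

end
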